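(* Let $d\in\{1,2\}$, $\boldsymbol\kappa\in\mathbb{R}^d\setminus\{0\}$, and let $\hat\eta_{\boldsymbol\kappa},\hat\varphi_{\boldsymbol\kappa}:[0,+\infty)\to\mathbb{C}$ satisfy $$\frac{d\hat\eta_{\boldsymbol\kappa}}{dt}=-\frac{2\pi|\boldsymbol\kappa|_2}{T_{1,\boldsymbol\kappa}+T_{2,\boldsymbol\kappa}}\hat\varphi_{\boldsymbol\kappa}-\hat g_{\boldsymbol\kappa},\qquad \frac{d\hat\varphi_{\boldsymbol\kappa}}{dt}=g(\rho_2-\rho_1)\hat\eta_{\boldsymbol\kappa}.$$ Let $$\hat\mu_{\boldsymbol\kappa}=\hat\eta_{\boldsymbol\kappa}+i\sqrt{\frac{2\pi|\boldsymbol\kappa|_2}{(T_{1,\boldsymbol\kappa}+T_{2,\boldsymbol\kappa})(\rho_2-\rho_1)g}}\;\hat\varphi_{\boldsymbol\kappa}.$$ Then the function $t\ge0\mapsto\hat\mu_{\boldsymbol\kappa}(t)\in\mathbb{C}$ satisfies $$\frac{d\hat\mu_{\boldsymbol\kappa}}{dt}=i\omega_{\boldsymbol\kappa}\hat\mu_{\boldsymbol\kappa}-\hat g_{\boldsymbol\kappa},\qquad\text{where}\quad \omega_{\boldsymbol\kappa}=\sqrt{\frac{2\pi|\boldsymbol\kappa|_2(\rho_2-\rho_1)g}{T_{1,\boldsymbol\kappa}+T_{2,\boldsymbol\kappa}}}.$$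
   Context: Constants: $0<\rho_1<\rho_2$, $h_1,h_2>0$, $g>0$ (gravitational acceleration); $|\cdot|_2$ is the Euclidean norm. $T_{j,\boldsymbol\kappa}=\rho_j\coth(2\pi|\boldsymbol\kappa|_2h_j)$ for $j=1,2$, and $$\hat g_{\boldsymbol\kappa}(t)=\frac{2\pi\rho_1\,i\,\boldsymbol\kappa\cdot\boldsymbol U(t)\,e^{-2\pi i\boldsymbol\kappa\cdot X(t)}\hat f_{\boldsymbol\kappa}}{\sinh(2\pi|\boldsymbol\kappa|_2h_1)(T_{1,\boldsymbol\kappa}+T_{2,\boldsymbol\kappa})},$$ where $\boldsymbol U(t)=X'(t)\in\mathbb{R}^d$ is the ship velocity, $X(t)$ its position, and $\hat f_{\boldsymbol\kappa}$ the Fourier transform at $\boldsymbol\kappa$ of the ship shape $f$. Here $\hat\eta_{\boldsymbol\kappa}(t)$, $\hat\varphi_{\boldsymbol\kappa}(t)$ are the Fourier transforms of the interface elevation and of the interface potential variable. *)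

theory Defs
  imports "HOL-Analysis.Analysis"
begin

definition coth :: "real \<Rightarrow> real" where
  "coth x = cosh x / sinh x"

(* The kernel is exp(-2 pi i k.x), with no prefactor; the integral is 0 if f is not integrable. *)
definition fourier_transform :: "(real ^ 'd::finite \<Rightarrow> real) \<Rightarrow> real ^ 'd \<Rightarrow> complex" where
  "fourier_transform f \<kappa> =
     (LINT x|lebesgue. exp (- (2 * complex_of_real pi * \<i> * complex_of_real (\<kappa> \<bullet> x)))
        * complex_of_real (f x))"

definition T_coef :: "real \<Rightarrow> real \<Rightarrow> real ^ 'd::finite \<Rightarrow> real" where
  "T_coef \<rho> h \<kappa> = \<rho> * coth (2 * pi * norm \<kappa> * h)"

definition g_hat ::
  "real \<Rightarrow> real \<Rightarrow> real \<Rightarrow> real \<Rightarrow> (real ^ 'd::finite \<Rightarrow> real) \<Rightarrow> (real \<Rightarrow> real ^ 'd) \<Rightarrow> (real \<Rightarrow> real ^ 'd)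
     \<Rightarrow> real ^ 'd \<Rightarrow> real \<Rightarrow> complex" where
  "g_hat \<rho>1 \<rho>2 h1 h2 f X U \<kappa> t =
     2 * complex_of_real pi * complex_of_real \<rho>1 * \<i> * complex_of_real (\<kappa> \<bullet> U t)
       * exp (- (2 * complex_of_real pi * \<i> * complex_of_real (\<kappa> \<bullet> X t)))
       * fourier_transform f \<kappa>
     / complex_of_real (sinh (2 * pi * norm \<kappa> * h1) * (T_coef \<rho>1 h1 \<kappa> + T_coef \<rho>2 h2 \<kappa>))"

definition mu_hat ::
  "real \<Rightarrow> real \<Rightarrow> real \<Rightarrow> real \<Rightarrow> real \<Rightarrow> real ^ 'd::finite \<Rightarrow> (real \<Rightarrow> complex) \<Rightarrow> (real \<Rightarrow> complex)
     \<Rightarrow> real \<Rightarrow> complex" where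
  "mu_hat g \<rho>1 \<rho>2 h1 h2 \<kappa> \<eta> \<phi> t =
     \<eta> t + \<i> * complex_of_real
       (sqrt (2 * pi * norm \<kappa> / ((T_coef \<rho>1 h1 \<kappa> + T_coef \<rho>2 h2 \<kappa>) * (\<rho>2 - \<rho>1) * g))) * \<phi> t"

definition omega :: "real \<Rightarrow> real \<Rightarrow> real \<Rightarrow> real \<Rightarrow> real \<Rightarrow> real ^ 'd::finite \<Rightarrow> real" where
  "omega g \<rho>1 \<rho>2 h1 h2 \<kappa> =
     sqrt (2 * pi * norm \<kappa> * (\<rho>2 - \<rho>1) * g / (T_coef \<rho>1 h1 \<kappa> + T_coef \<rho>2 h2 \<kappa>))"

end

theory Submission
  imports Defs
begin

text \<open>Put b = 2 pi |\<kappa>| / (T1 + T2) and s = g (\<rho>2 - \<rho>1). The system reads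
  \<eta>' = -b \<phi> - G, \<phi>' = s \<eta>: a forced harmonic oscillator of frequency w = sqrt (b
  s). Rescaling \<phi> by c = sqrt (b / s) turns the homogeneous part into a plain rotation, because
  c s = w and w c = b. Hence \<eta> + i c \<phi> is an eigencombination with eigenvalue i w, and the
  forcing, present only in the equation for \<eta>, passes into its equation unchanged.
  \<open>has_vector_derivative_oscillator_complex\<close> is this computation;
  \<open>T_coef_pos\<close> makes T1 + T2 positive, so that the roots behave as expected.\<close>

lemma T_coef_pos:
  assumes "0 < \<rho>" "0 < h" "\<kappa> \<noteq> 0"
  shows "0 < T_coef \<rho> h \<kappa>"
  using assms by (simp add: T_coef_def coth_def)

lemma sqrt_divide_mult_self:
  fixes b s :: real
  assumes "0 \<le> s"
  shows "sqrt (b / s) * s = sqrt (b * s)"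
  \<comment> \<open>For s = 0 both sides vanish. Otherwise s / sqrt s = sqrt s, and
    \<open>sqrt\<close> is odd and multiplicative on all reals, so negative b is covered
    too.\<close>
  using assms by (cases "s = 0") (simp_all add: real_sqrt_divide real_sqrt_mult field_simps)

lemma sqrt_mult_sqrt_divide:
  fixes b s :: real
  assumes "0 \<le> b" "0 < s"
  shows "sqrt (b * s) * sqrt (b / s) = b"
  using assms by (simp add: real_sqrt_divide real_sqrt_mult)

text \<open>The diagonalisation at a single time t, with G the value of the forcing there.
  Differentiating within a set A includes the one-sided derivative at t = 0.\<close>

lemma has_vector_derivative_oscillator_complex:
  fixes \<eta> \<phi> :: "real \<Rightarrow> complex" and b s :: real
  assumes "0 \<le> b" "0 < s"
    and \<eta>: "(\<eta> has_vector_derivative - complex_of_real b * \<phi> t - G) (at t within A)"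
    and \<phi>: "(\<phi> has_vector_derivative complex_of_real s * \<eta> t) (at t within A)"
  shows "((\<lambda>t. \<eta> t + \<i> * complex_of_real (sqrt (b / s)) * \<phi> t) has_vector_derivative
      \<i> * complex_of_real (sqrt (b * s)) * (\<eta> t + \<i> * complex_of_real (sqrt (b / s)) * \<phi> t) - G)
      (at t within A)"
proof -
  define c w where "c = complex_of_real (sqrt (b / s))" and "w = complex_of_real (sqrt (b * s))"
  have cs: "c * complex_of_real s = w"
    using assms(2) unfolding c_def w_def of_real_mult [symmetric]
    by (simp only: sqrt_divide_mult_self less_imp_le)
  have wc: "w * c = complex_of_real b"
    using assms(1,2) unfolding c_def w_def of_real_mult [symmetric]
    by (simp only: sqrt_mult_sqrt_divide)
  have "((\<lambda>t. \<eta> t + \<i> * c * \<phi> t) has_vector_derivative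
      - complex_of_real b * \<phi> t - G + \<i> * c * (complex_of_real s * \<eta> t)) (at t within A)"
    by (intro has_vector_derivative_add has_vector_derivative_mult_right \<eta> \<phi>)
  also have "- complex_of_real b * \<phi> t - G + \<i> * c * (complex_of_real s * \<eta> t)
      = \<i> * w * (\<eta> t + \<i> * c * \<phi> t) - G"
    \<comment> \<open>The coefficients agree: i c s = i w for \<eta>, and (i w)(i c) = -w c = -b for
      \<phi>. Rewriting b to w c and then w to c s leaves a polynomial identity in c and s.\<close>
    by (simp add: wc [symmetric] cs [symmetric] algebra_simps)
  finally show ?thesis
    by (simp only: c_def w_def)
qed

theorem proposition2:
  fixes \<rho>1 \<rho>2 h1 h2 g :: real
    and \<kappa> :: "real ^ 'd::finite"
    and f :: "real ^ 'd \<Rightarrow> real"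
    and X U :: "real \<Rightarrow> real ^ 'd"
    and \<eta> \<phi> :: "real \<Rightarrow> complex"
  assumes "0 < \<rho>1" and "\<rho>1 < \<rho>2" and "0 < h1" and "0 < h2" and "0 < g"
    and "CARD('d) \<in> {1, 2}"
    and "\<kappa> \<noteq> 0"
    and "\<And>t. t \<ge> 0 \<Longrightarrow> (X has_vector_derivative U t) (at t within {0..})"
    and "\<And>t. t \<ge> 0 \<Longrightarrow>
      (\<eta> has_vector_derivative
        - complex_of_real (2 * pi * norm \<kappa> / (T_coef \<rho>1 h1 \<kappa> + T_coef \<rho>2 h2 \<kappa>)) * \<phi> t
          - g_hat \<rho>1 \<rho>2 h1 h2 f X U \<kappa> t) (at t within {0..})"
    and "\<And>t. t \<ge> 0 \<Longrightarrow>
      (\<phi> has_vector_derivative complex_of_real (g * (\<rho>2 - \<rho>1)) * \<eta> t) (at t within {0..})"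
  shows "\<forall>t\<ge>0.
      (mu_hat g \<rho>1 \<rho>2 h1 h2 \<kappa> \<eta> \<phi> has_vector_derivative
        \<i> * complex_of_real (omega g \<rho>1 \<rho>2 h1 h2 \<kappa>) * mu_hat g \<rho>1 \<rho>2 h1 h2 \<kappa> \<eta> \<phi> t
          - g_hat \<rho>1 \<rho>2 h1 h2 f X U \<kappa> t) (at t within {0..})"
proof (intro allI impI)
  fix t :: real
  assume t: "t \<ge> 0"
  define T where "T = T_coef \<rho>1 h1 \<kappa> + T_coef \<rho>2 h2 \<kappa>"
  define b where "b = 2 * pi * norm \<kappa> / T"
  define s where "s = g * (\<rho>2 - \<rho>1)"
  have "0 < T"
    unfolding T_def using assms(1-4,7) by (intro add_pos_pos T_coef_pos) auto
  then have "0 \<le> b"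
    by (simp add: b_def)
  have "0 < s"
    using assms(2,5) by (simp add: s_def)
  \<comment> \<open>Under the roots, the quotient in \<open>mu_hat\<close> regroups as b / s and the
    one in \<open>omega\<close> as b s.\<close>
  have mu: "mu_hat g \<rho>1 \<rho>2 h1 h2 \<kappa> \<eta> \<phi>
      = (\<lambda>t. \<eta> t + \<i> * complex_of_real (sqrt (b / s)) * \<phi> t)"
    by (simp add: fun_eq_iff mu_hat_def b_def s_def T_def mult_ac)
  have om: "omega g \<rho>1 \<rho>2 h1 h2 \<kappa> = sqrt (b * s)"
    by (simp add: omega_def b_def s_def T_def mult_ac)
  show "(mu_hat g \<rho>1 \<rho>2 h1 h2 \<kappa> \<eta> \<phi> has_vector_derivative
        \<i> * complex_of_real (omega g \<rho>1 \<rho>2 h1 h2 \<kappa>) * mu_hat g \<rho>1 \<rho>2 h1 h2 \<kappa> \<eta> \<phi> t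
          - g_hat \<rho>1 \<rho>2 h1 h2 f X U \<kappa> t) (at t within {0..})"
    unfolding mu om
    using \<open>0 \<le> b\<close> \<open>0 < s\<close> assms(9) [OF t] assms(10) [OF t]
    unfolding T_def [symmetric] b_def [symmetric] s_def [symmetric]
    by (rule has_vector_derivative_oscillator_complex)
qed

end
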